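(* Let $G$ be a graph and let $H$ be a rooted graph with root $r_H \in V(H)$. Then \[ b(G \,\square\, H) \le b(G \circ H) \le b(G) + \operatorname{ecc}(r_H). \]
   Context: All graphs are finite. For a graph $G$, $d(u,v)$ is graph distance and $B(v,r)=\{u\in V(G): d(u,v)\le r\}$. The burning number is $b(G)=\min\{k : \exists v_1,\dots,v_k\in V(G) \text{ with } V(G)=\bigcup_{i=1}^k B(v_i,k-i)\}$; equivalently, it is the minimum number of rounds needed to burn all vertices when in each round every burning vertex spreads fire to all its neighbors and one new fire may be started at an unburned vertex. $G\,\square\,H$ denotes the Cartesian product. For a rooted graph $H$ with root $r_H$, the rooted product $G\circ H$ is obtained by taking one copy of $G$ and, for each $v\in V(G)$, attaching a separate copy of $H$ by identifying $v$ with the root $r_H$ of that copy. The eccentricity of a vertex $v$ of $H$ is $\operatorname{ecc}(v)=\max_{u\in V(H)} d(u,v)$. *)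

theory Defs
  imports "Graph_Theory.Pair_Digraph" "HOL-Library.Extended_Nat"
begin

text \<open>
  Finite simple graphs are the library's \<open>pair_graph\<close>s: finite, loop-free, symmetric digraphs
  without parallel arcs. Connectedness is not assumed, so distances take values in \<open>enat\<close>.
\<close>

definition gdist :: "'a pair_pre_digraph \<Rightarrow> 'a \<Rightarrow> 'a \<Rightarrow> enat" where
  "gdist G u v = (INF p \<in> {p. pre_digraph.awalk (with_proj G) u p v}. enat (length p))"

definition gball :: "'a pair_pre_digraph \<Rightarrow> 'a \<Rightarrow> nat \<Rightarrow> 'a set" where
  "gball G v r = {u \<in> pverts G. gdist G u v \<le> enat r}"

definition ecc :: "'a pair_pre_digraph \<Rightarrow> 'a \<Rightarrow> enat" where
  "ecc G v = Max ((\<lambda>u. gdist G u v) ` pverts G)"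

definition burns_in :: "'a pair_pre_digraph \<Rightarrow> nat \<Rightarrow> bool" where
  "burns_in G k \<longleftrightarrow>
     (\<exists>v :: nat \<Rightarrow> 'a. (\<forall>i\<in>{1..k}. v i \<in> pverts G) \<and>
        pverts G = (\<Union>i\<in>{1..k}. gball G (v i) (k - i)))"

definition burning_number :: "'a pair_pre_digraph \<Rightarrow> nat" where
  "burning_number G = (LEAST k. burns_in G k)"

definition cartesian_product ::
  "'a pair_pre_digraph \<Rightarrow> 'b pair_pre_digraph \<Rightarrow> ('a \<times> 'b) pair_pre_digraph" where
  "cartesian_product G H =
     \<lparr> pverts = pverts G \<times> pverts H,
       parcs = {((g, h), (g', h')) | g h g' h'.
                  (g = g' \<and> g \<in> pverts G \<and> (h, h') \<in> parcs H) \<or>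
                  (h = h' \<and> h \<in> pverts H \<and> (g, g') \<in> parcs G)} \<rparr>"

text \<open>
  In the rooted product, \<open>(g, h)\<close> is the vertex \<open>h\<close> in the copy of \<open>H\<close> attached at \<open>g\<close>.
  The vertex \<open>g\<close> of \<open>G\<close> is identified with the root \<open>(g, r)\<close> of that copy.
\<close>

definition rooted_product ::
  "'a pair_pre_digraph \<Rightarrow> 'b pair_pre_digraph \<Rightarrow> 'b \<Rightarrow> ('a \<times> 'b) pair_pre_digraph" where
  "rooted_product G H r =
     \<lparr> pverts = pverts G \<times> pverts H,
       parcs = {((g, r), (g', r)) | g g'. (g, g') \<in> parcs G} \<union>
               {((g, h), (g, h')) | g h h'. g \<in> pverts G \<and> (h, h') \<in> parcs H} \<rparr>"

lemma gdist_self: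
  assumes "u \<in> pverts G"
  shows "gdist G u u = 0"
proof -
  have "pre_digraph.awalk (with_proj G) u [] u"
    using assms by (simp add: pre_digraph.awalk_def pre_digraph.cas.simps)
  then have "gdist G u u \<le> enat (length ([] :: ('a \<times> 'a) list))"
    unfolding gdist_def by (intro INF_lower) simp
  then show ?thesis by (simp add: zero_enat_def[symmetric])
qed

lemma burns_in_card:
  assumes "finite (pverts G)"
  shows "burns_in G (card (pverts G))"
proof -
  obtain v where v: "bij_betw v {1..card (pverts G)} (pverts G)"
    using ex_bij_betw_nat_finite_1[OF assms] by blast
  have img: "v ` {1..card (pverts G)} = pverts G"
    using v by (rule bij_betw_imp_surj_on)
  have "pverts G \<subseteq> (\<Union>i\<in>{1..card (pverts G)}. gball G (v i) (card (pverts G) - i))"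
  proof
    fix u
    assume u: "u \<in> pverts G"
    then obtain i where i: "i \<in> {1..card (pverts G)}" "u = v i"
      using img by blast
    have "u \<in> gball G (v i) (card (pverts G) - i)"
      using u gdist_self[OF u] by (simp add: gball_def i(2)[symmetric])
    with i(1) show "u \<in> (\<Union>i\<in>{1..card (pverts G)}. gball G (v i) (card (pverts G) - i))"
      by blast
  qed
  moreover have "(\<Union>i\<in>{1..card (pverts G)}. gball G (v i) (card (pverts G) - i)) \<subseteq> pverts G"
    by (auto simp: gball_def)
  moreover have "\<forall>i\<in>{1..card (pverts G)}. v i \<in> pverts G"
    using img by blast
  ultimately show ?thesis
    unfolding burns_in_def by blast
qed

lemma burns_in_burning_number:
  assumes "finite (pverts G)"
  shows "burns_in G (burning_number G)"
  unfolding burning_number_def by (rule LeastI, rule burns_in_card[OF assms])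

lemma pair_graph_cartesian_product:
  assumes "pair_graph G" "pair_graph H"
  shows "pair_graph (cartesian_product G H)"
proof -
  interpret G: pair_graph G by fact
  interpret H: pair_graph H by fact
  let ?P = "cartesian_product G H"
  have sub: "parcs ?P \<subseteq> pverts ?P \<times> pverts ?P"
    by (auto simp: cartesian_product_def dest: G.wellformed' H.wellformed')
  have fin: "finite (pverts ?P)"
    by (simp add: cartesian_product_def G.pair_finite_verts H.pair_finite_verts)
  show ?thesis
  proof
    show "finite (parcs ?P)"
      by (rule finite_subset[OF sub finite_cartesian_product[OF fin fin]])
    show "symmetric (with_proj ?P)"
      using G.arcs_symmetric H.arcs_symmetric
      by (simp add: symmetric_def sym_def cartesian_product_def) blast
    show "fst e \<noteq> snd e" if "e \<in> parcs ?P" for e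
      using that by (auto simp: cartesian_product_def dest: G.no_loops' H.no_loops')
  qed (use sub fin in auto)
qed

lemma pair_graph_rooted_product:
  assumes "pair_graph G" "pair_graph H" "r \<in> pverts H"
  shows "pair_graph (rooted_product G H r)"
proof -
  interpret G: pair_graph G by fact
  interpret H: pair_graph H by fact
  let ?P = "rooted_product G H r"
  have sub: "parcs ?P \<subseteq> pverts ?P \<times> pverts ?P"
    using assms(3) by (auto simp: rooted_product_def dest: G.wellformed' H.wellformed')
  have fin: "finite (pverts ?P)"
    by (simp add: rooted_product_def G.pair_finite_verts H.pair_finite_verts)
  show ?thesis
  proof
    show "finite (parcs ?P)"
      by (rule finite_subset[OF sub finite_cartesian_product[OF fin fin]])
    show "symmetric (with_proj ?P)"
      using G.arcs_symmetric H.arcs_symmetric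
      by (simp add: symmetric_def sym_def rooted_product_def)
    show "fst e \<noteq> snd e" if "e \<in> parcs ?P" for e
      using that by (auto simp: rooted_product_def dest: G.no_loops' H.no_loops')
  qed (use sub fin in auto)
qed

end

theory Submission
  imports Defs
begin

text \<open>
  The rooted product is a spanning subgraph of the Cartesian product, so a burning sequence of the
  former also burns the latter. For the upper bound, play a burning sequence of \<open>G\<close> on the roots:
  all roots burn within \<open>b(G)\<close> rounds, and \<open>ecc(r)\<close> further rounds burn every copy of \<open>H\<close>.
\<close>

lemma awalk_hom:
  assumes verts: "\<And>x. x \<in> pverts G \<Longrightarrow> f x \<in> pverts H"
    and arcs: "\<And>x y. (x, y) \<in> parcs G \<Longrightarrow> (f x, f y) \<in> parcs H"
    and walk: "pre_digraph.awalk (with_proj G) u p v"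
  shows "pre_digraph.awalk (with_proj H) (f u) (map (map_prod f f) p) (f v)"
proof -
  have "pre_digraph.cas (with_proj H) (f u) (map (map_prod f f) p) (f v)"
    if "pre_digraph.cas (with_proj G) u p v" for u
    using that by (induction p arbitrary: u) (auto simp: pre_digraph.cas.simps)
  then show ?thesis
    using walk verts arcs by (auto simp: pre_digraph.awalk_def)
qed

text \<open>A homomorphism sends each walk to a walk of the same length. It is applied to three
  maps: the identity into a supergraph, the embedding of \<open>G\<close> on the roots, and the
  embedding of \<open>H\<close> as one copy.\<close>

lemma gdist_hom:
  assumes "\<And>x. x \<in> pverts G \<Longrightarrow> f x \<in> pverts H"
    and "\<And>x y. (x, y) \<in> parcs G \<Longrightarrow> (f x, f y) \<in> parcs H"
  shows "gdist H (f u) (f v) \<le> gdist G u v"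
  unfolding gdist_def
proof (rule INF_mono)
  fix p assume "p \<in> {p. pre_digraph.awalk (with_proj G) u p v}"
  then have "pre_digraph.awalk (with_proj H) (f u) (map (map_prod f f) p) (f v)"
    using awalk_hom[of G f H, OF assms] by blast
  then show "\<exists>q\<in>{q. pre_digraph.awalk (with_proj H) (f u) q (f v)}. enat (length q) \<le> enat (length p)"
    by (intro bexI[of _ "map (map_prod f f) p"]) auto
qed

text \<open>A finite bound on the infimum is witnessed by an actual walk: if all walks were longer
  than \<open>n\<close>, the infimum would be at least \<open>Suc n\<close>.\<close>

lemma gdist_le_enat_iff:
  "gdist G u v \<le> enat n \<longleftrightarrow> (\<exists>p. pre_digraph.awalk (with_proj G) u p v \<and> length p \<le> n)"
proof
  assume *: "gdist G u v \<le> enat n"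
  show "\<exists>p. pre_digraph.awalk (with_proj G) u p v \<and> length p \<le> n"
  proof (rule ccontr)
    assume "\<not> ?thesis"
    then have "enat (Suc n) \<le> gdist G u v"
      unfolding gdist_def by (intro INF_greatest) (auto simp: not_le)
    with * have "enat (Suc n) \<le> enat n"
      by (rule order_trans[rotated])
    then show False by simp
  qed
next
  assume "\<exists>p. pre_digraph.awalk (with_proj G) u p v \<and> length p \<le> n"
  then show "gdist G u v \<le> enat n"
    unfolding gdist_def by (auto intro!: INF_lower2)
qed

text \<open>Concatenates two walks; the finite bounds guarantee that both exist.\<close>

lemma gdist_triangle_enat:
  assumes "pair_wf_digraph G" "gdist G u v \<le> enat m" "gdist G v w \<le> enat n"
  shows "gdist G u w \<le> enat (m + n)"
proof -
  interpret pair_wf_digraph G by fact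
  obtain p q where "awalk u p v" "length p \<le> m" "awalk v q w" "length q \<le> n"
    using assms(2,3) by (auto simp: gdist_le_enat_iff)
  then show ?thesis
    unfolding gdist_le_enat_iff by (intro exI[of _ "p @ q"]) auto
qed

lemma burning_number_le: "burns_in G k \<Longrightarrow> burning_number G \<le> k"
  unfolding burning_number_def by (rule Least_le)

text \<open>Extra arcs only shorten distances, so every ball grows and the same centres still
  cover.\<close>

lemma burns_in_supergraph:
  assumes "pverts G = pverts H" "parcs G \<subseteq> parcs H" "burns_in G k"
  shows "burns_in H k"
proof -
  have "gdist H u v \<le> gdist G u v" for u v
    using gdist_hom[of G "\<lambda>x. x" H u v] assms(1,2) by auto
  then have ball: "gball G v n \<subseteq> gball H v n" for v n
    using assms(1) unfolding gball_def by (auto intro: order_trans)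
  obtain v where v: "\<forall>i\<in>{1..k}. v i \<in> pverts H"
    and cover: "pverts H = (\<Union>i\<in>{1..k}. gball G (v i) (k - i))"
    using assms(1,3) unfolding burns_in_def by auto
  have "pverts H \<subseteq> (\<Union>i\<in>{1..k}. gball H (v i) (k - i))"
    by (subst cover) (intro UN_mono order_refl ball)
  moreover have "(\<Union>i\<in>{1..k}. gball H (v i) (k - i)) \<subseteq> pverts H"
    by (auto simp: gball_def)
  ultimately show ?thesis
    unfolding burns_in_def using v by (intro exI[of _ v] conjI equalityI)
qed

lemma gdist_le_ecc:
  assumes "finite (pverts H)" "h \<in> pverts H"
  shows "gdist H h r \<le> ecc H r"
  unfolding ecc_def using assms by (intro Max_ge) auto

text \<open>From \<open>(g, h)\<close> one reaches the root \<open>(g, r)\<close> within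
  \<open>e\<close> steps, and from there fire \<open>i\<close> within \<open>k - i\<close> steps
  along the roots. The assumption \<open>k > 0\<close> makes \<open>v 1\<close> a vertex of
  \<open>G\<close>, available for the late fires.\<close>

lemma burns_in_rooted_product:
  assumes G: "pair_graph G" and H: "pair_graph H" and r: "r \<in> pverts H"
    and ecc: "ecc H r = enat e" and burns: "burns_in G k" and "k > 0"
  shows "burns_in (rooted_product G H r) (k + e)"
proof -
  let ?P = "rooted_product G H r"
  interpret H: pair_graph H by fact
  interpret P: pair_graph ?P by (rule pair_graph_rooted_product[OF G H r])
  obtain v where v: "\<forall>i\<in>{1..k}. v i \<in> pverts G"
    and cover: "pverts G = (\<Union>i\<in>{1..k}. gball G (v i) (k - i))"
    using burns unfolding burns_in_def by blast
  \<comment> \<open>The last \<open>e\<close> fires are superfluous; they may be lit anywhere.\<close>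
  define w where "w i = (if i \<le> k then v i else v 1, r)" for i
  have "w i \<in> pverts ?P" if "i \<in> {1..k + e}" for i
    using that v r \<open>k > 0\<close> by (auto simp: w_def rooted_product_def)
  moreover have "\<exists>i\<in>{1..k + e}. (g, h) \<in> gball ?P (w i) (k + e - i)"
    if g: "g \<in> pverts G" and h: "h \<in> pverts H" for g h
  proof -
    obtain i where i: "i \<in> {1..k}" and "gdist G g (v i) \<le> enat (k - i)"
      using g equalityD1[OF cover] unfolding gball_def by blast
    moreover have "gdist ?P (g, r) (v i, r) \<le> gdist G g (v i)"
      by (rule gdist_hom[where f = "\<lambda>x. (x, r)"]) (use r in \<open>auto simp: rooted_product_def\<close>)
    ultimately have root: "gdist ?P (g, r) (v i, r) \<le> enat (k - i)"
      by simp
    have "gdist ?P (g, h) (g, r) \<le> gdist H h r"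
      by (rule gdist_hom[where f = "Pair g"]) (use g in \<open>auto simp: rooted_product_def\<close>)
    then have "gdist ?P (g, h) (g, r) \<le> enat e"
      using gdist_le_ecc[OF H.pair_finite_verts h, of r] ecc by simp
    then have "gdist ?P (g, h) (v i, r) \<le> enat (e + (k - i))"
      using root by (rule gdist_triangle_enat[OF P.pair_wf_digraph_axioms])
    \<comment> \<open>The total is exactly the radius of fire \<open>i\<close> in
      \<open>k + e\<close> rounds; \<open>i \<le> k\<close> keeps the subtraction from
      truncating.\<close>
    moreover have "e + (k - i) = k + e - i"
      using i by simp
    ultimately show ?thesis
      using i g h by (intro bexI[of _ i]) (auto simp: w_def gball_def rooted_product_def)
  qed
  then have "pverts ?P \<subseteq> (\<Union>i\<in>{1..k + e}. gball ?P (w i) (k + e - i))"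
    by (auto simp: rooted_product_def)
  moreover have "(\<Union>i\<in>{1..k + e}. gball ?P (w i) (k + e - i)) \<subseteq> pverts ?P"
    by (auto simp: gball_def)
  ultimately show ?thesis
    unfolding burns_in_def by (intro exI[of _ w] conjI equalityI ballI)
qed

theorem theorem1p2:
  fixes G :: "'a pair_pre_digraph" and H :: "'b pair_pre_digraph" and r :: 'b
  assumes "pair_graph G" and "pair_graph H" and "r \<in> pverts H"
  shows "burning_number (cartesian_product G H) \<le> burning_number (rooted_product G H r) \<and>
         enat (burning_number (rooted_product G H r)) \<le> enat (burning_number G) + ecc H r"
proof
  let ?P = "rooted_product G H r"
  interpret G: pair_graph G by fact
  interpret P: pair_graph ?P by (rule pair_graph_rooted_product[OF assms])
  show "burning_number (cartesian_product G H) \<le> burning_number ?P"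
  proof (rule burning_number_le[OF burns_in_supergraph])
    show "burns_in ?P (burning_number ?P)"
      by (rule burns_in_burning_number[OF P.pair_finite_verts])
  \<comment> \<open>Arcs between roots are Cartesian arcs in the layer of \<open>r\<close>, which is
    a layer because \<open>r \<in> pverts H\<close>.\<close>
  qed (use assms(3) in \<open>auto simp: rooted_product_def cartesian_product_def\<close>)
  have burns: "burns_in G (burning_number G)"
    by (rule burns_in_burning_number[OF G.pair_finite_verts])
  show "enat (burning_number ?P) \<le> enat (burning_number G) + ecc H r"
  \<comment> \<open>If some vertex of \<open>H\<close> is unreachable from \<open>r\<close>, the
    eccentricity is infinite and the bound is trivial.\<close>
  proof (cases "ecc H r")
    case (enat e)
    show ?thesis
    proof (cases "burning_number G = 0")
      \<comment> \<open>Zero rounds suffice only for an empty \<open>G\<close>, and then the product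
        is empty too.\<close>
      case True
      then have "burns_in ?P 0"
        using burns by (auto simp: burns_in_def rooted_product_def)
      then show ?thesis
        using burning_number_le[of ?P 0] by (simp add: zero_enat_def[symmetric])
    next
      case False
      then have "burning_number ?P \<le> burning_number G + e"
        by (intro burning_number_le burns_in_rooted_product[OF assms enat burns]) simp
      then show ?thesis
        using enat by simp
    qed
  qed simp
qed

end
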